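(* Let $L>0$ be a constant and let $z^*=(x^*,y^* )\in F$. Then $z^*$ is an $L$-like stationary point of the problem $\min\{f(z):z\in F\}$ if and only if $$|\nabla_if(z^* )|\begin{cases}=0&\text{if }i\in\Gamma^*,\\ \le L\,M_s(|x^*|)&\text{if }i\in I_1\setminus\Gamma_1^*,\\ \le L\,M_t(|y^*|)&\text{if }i\in I_2\setminus\Gamma_2^*.\end{cases}$$
   Context: $l,m,n,s,t$ are positive integers with $s<m$, $t<n$; $\mathscr{A}=(a_{ijk})\in\mathbb{R}^{l\times m\times n}$ and $b\in\mathbb{R}^l$ are given. For $x\in\mathbb{R}^m$, $y\in\mathbb{R}^n$, $\mathscr{A}xy\in\mathbb{R}^l$ has entries $(\mathscr{A}xy)_i=\sum_{j,k}a_{ijk}x_jy_k$, and $f(z)=f(x,y)=\frac12\|\mathscr{A}xy-b\|^2$ for $z=(x,y)\in\mathbb{R}^{m+n}$; $\nabla_if$ is the $i$-th component of $\nabla f$. $I=\{1,\dots,m+n\}$, $I_1=\{1,\dots,m\}$, $I_2=\{m+1,\dots,m+n\}$; coordinates of $y$ are indexed by $I_2$. $\Gamma^*=\{i\in I:z_i^*\ne0\}$, $\Gamma_1^*=\Gamma^*\cap I_1$, $\Gamma_2^*=\Gamma^*\cap I_2$. $|x|$ is the entrywise absolute value and $M_i(v)$ is the value of the $i$-th largest entry of the vector $v$. $\|\cdot\|_0$ counts nonzero entries. For $x\ne0$, $\gamma_x$ is the index of the first nonzero entry of $x$. $F_1=\{x\in\mathbb{R}^m:\|x\|_0\le s,\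 e_{\gamma_x}^\top x=1\}$ (nonzero vectors with at most $s$ nonzero entries and first nonzero entry equal to $1$), $F_2=\{y\in\mathbb{R}^n:\|y\|_0\le t\}$, $F=F_1\times F_2$. Like-projection: for $z=(x,y)\in\mathbb{R}^{m+n}$ define $\psi_z$ by: if $x=0$, $\psi_z(u)=u$; if $x\ne0$, $(\psi_z(u))_i=x_{\gamma_u^z}u_i$ for $i\in I_1$ and $(\psi_z(u))_i=u_i/x_{\gamma_u^z}$ for $i\in I_2$, where $\gamma_u^z:=\min\{i\in I_1:u_i\ne0,\ z_i\ne0\}$. The like-projection of $z$ onto $F$ is the set $\bar{\mathbf P}_F(z)=\arg\min_{u\in F}\|\psi_z(u)-z\|^2$, the minimum being over those $u\in F$ for which $\psi_z(u)$ is defined (for $x\neq 0$, those for which the index set defining $\gamma_u^z$ is nonempty). $z^*=(x^*,y^* )\in F$ is an $L$-like stationary point if $z^*\in\bar{\mathbf P}_F(z^*-\nabla f(z^* )/L)$ and $\nabla_{\gamma_{x^*}}f(z^* )=0$. *)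

theory Defs
  imports "HOL-Analysis.Analysis"
begin

text \<open>
  The space $R^{m+n}$ is the product Euclidean space \<open>(real^'m) \<times> (real^'n)\<close>, so that \<open>z = (x, y)\<close> is
  literally a pair. The index set \<open>I\<close> is the disjoint sum \<open>'m + 'n\<close>, with \<open>I\<^sub>1 = range Inl\<close> and
  \<open>I\<^sub>2 = range Inr\<close>. The index type \<open>'m\<close> is a finite linear order (that is, \<open>{1..m}\<close> up to
  isomorphism), because the first nonzero entry of \<open>x\<close> has to make sense.
\<close>

definition coord :: "(real^'m) \<times> (real^'n) \<Rightarrow> 'm + 'n \<Rightarrow> real" where
  "coord z i = (case i of Inl j \<Rightarrow> fst z $ j | Inr k \<Rightarrow> snd z $ k)"

definition supp :: "(real^'m) \<times> (real^'n) \<Rightarrow> ('m + 'n) set" where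
  "supp z = {i. coord z i \<noteq> 0}"

abbreviation I1 :: "('m + 'n) set" where "I1 \<equiv> range Inl"
abbreviation I2 :: "('m + 'n) set" where "I2 \<equiv> range Inr"

definition l0norm :: "real^'k \<Rightarrow> nat" where
  "l0norm x = card {i. x $ i \<noteq> 0}"

text \<open>The \<open>k\<close>-th largest entry, counted with multiplicity and starting from \<open>k = 1\<close>; meaningful for
  \<open>1 \<le> k \<le> CARD('k)\<close>.\<close>

definition kth_largest :: "nat \<Rightarrow> real^'k \<Rightarrow> real" where
  "kth_largest k v =
     rev (sorted_list_of_multiset (image_mset (\<lambda>i. v $ i) (mset_set UNIV))) ! (k - 1)"

text \<open>Meaningful for \<open>x \<noteq> 0\<close> only.\<close>

definition first_nz :: "real^'m::{finite,linorder} \<Rightarrow> 'm::{finite,linorder}" where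
  "first_nz x = Min {i. x $ i \<noteq> 0}"

definition F1 :: "nat \<Rightarrow> (real^'m::{finite,linorder}) set" where
  "F1 s = {x. x \<noteq> 0 \<and> l0norm x \<le> s \<and> x $ first_nz x = 1}"

definition F2 :: "nat \<Rightarrow> (real^'n) set" where
  "F2 t = {y. l0norm y \<le> t}"

definition feasible :: "nat \<Rightarrow> nat \<Rightarrow> ((real^'m::{finite,linorder}) \<times> (real^'n)) set" where
  "feasible s t = F1 s \<times> F2 t"

text \<open>The entry \<open>a\<^sub>i\<^sub>j\<^sub>k\<close> of the tensor is \<open>A $ i $ j $ k\<close>.\<close>

definition tensor_app :: "real^'n^'m^'l \<Rightarrow> real^'m \<Rightarrow> real^'n \<Rightarrow> real^'l" where
  "tensor_app A x y = (\<chi> i. \<Sum>j\<in>UNIV. \<Sum>k\<in>UNIV. A $ i $ j $ k * x $ j * y $ k)"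

definition objective :: "real^'n^'m^'l \<Rightarrow> real^'l \<Rightarrow> (real^'m) \<times> (real^'n) \<Rightarrow> real" where
  "objective A b z = 1/2 * (norm (tensor_app A (fst z) (snd z) - b))\<^sup>2"

definition grad :: "('a::real_inner \<Rightarrow> real) \<Rightarrow> 'a \<Rightarrow> 'a" where
  "grad f z = (THE g. GDERIV f z :> g)"

lemma grad_eqI:
  assumes "GDERIV f z :> g"
  shows "grad f z = g"
  unfolding grad_def
proof (rule the_equality)
  show "GDERIV f z :> g" by (rule assms)
next
  fix h assume "GDERIV f z :> h"
  then have "(\<lambda>v. inner v h) = (\<lambda>v. inner v g)"
    using assms unfolding gderiv_def by (rule has_derivative_unique)
  then show "h = g"
    by (metis inner_commute vector_eq_rdot)
qed

text \<open>The transformation \<open>\<psi>\<^sub>z\<close> is partial for \<open>fst z \<noteq> 0\<close>; \<open>psi_dom z\<close> is the set of those \<open>u\<close> at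
  which it is defined, i.e. for which the minimum in \<open>common_nz z u\<close> is over a nonempty set.\<close>

definition common_nz ::
  "(real^'m::{finite,linorder}) \<times> (real^'n) \<Rightarrow> (real^'m::{finite,linorder}) \<times> (real^'n) \<Rightarrow> 'm::{finite,linorder}" where
  "common_nz z u = Min {i. fst u $ i \<noteq> 0 \<and> fst z $ i \<noteq> 0}"

definition psi_dom ::
  "(real^'m::{finite,linorder}) \<times> (real^'n) \<Rightarrow> ((real^'m::{finite,linorder}) \<times> (real^'n)) set" where
  "psi_dom z = {u. fst z \<noteq> 0 \<longrightarrow> {i. fst u $ i \<noteq> 0 \<and> fst z $ i \<noteq> 0} \<noteq> {}}"

definition psi ::
  "(real^'m::{finite,linorder}) \<times> (real^'n) \<Rightarrow> (real^'m::{finite,linorder}) \<times> (real^'n) \<Rightarrow> (real^'m::{finite,linorder}) \<times> (real^'n)" where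
  "psi z u =
     (if fst z = 0 then u
      else let c = fst z $ common_nz z u in (c *\<^sub>R fst u, (1 / c) *\<^sub>R snd u))"

definition like_projection ::
  "((real^'m::{finite,linorder}) \<times> (real^'n)) set \<Rightarrow> (real^'m::{finite,linorder}) \<times> (real^'n) \<Rightarrow> ((real^'m::{finite,linorder}) \<times> (real^'n)) set" where
  "like_projection F z =
     {u. is_arg_min (\<lambda>u. (norm (psi z u - z))\<^sup>2) (\<lambda>u. u \<in> F \<and> u \<in> psi_dom z) u}"

definition like_stationary ::
  "real \<Rightarrow> ((real^'m::{finite,linorder}) \<times> (real^'n) \<Rightarrow> real) \<Rightarrow> ((real^'m::{finite,linorder}) \<times> (real^'n)) set
    \<Rightarrow> (real^'m::{finite,linorder}) \<times> (real^'n) \<Rightarrow> bool" where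
  "like_stationary L f F z \<longleftrightarrow>
     z \<in> F \<and> z \<in> like_projection F (z - (1 / L) *\<^sub>R grad f z) \<and>
     coord (grad f z) (Inl (first_nz (fst z))) = 0"

end

theory Submission
  imports Defs
begin

text \<open>
  Write \<open>w = z\<^sup>* - g / L\<close> with \<open>g\<close> the gradient at \<open>z\<^sup>* = (x\<^sup>*, y\<^sup>*)\<close>. If \<open>g\<close> vanishes at the first
  nonzero position \<open>p\<close> of \<open>x\<^sup>*\<close>, then \<open>w\<close> and \<open>x\<^sup>*\<close> agree there with common value \<open>1\<close>, so the scaling
  factor in \<open>\<psi>\<^sub>w z\<^sup>*\<close> is \<open>1\<close> and \<open>\<psi>\<^sub>w\<close> fixes \<open>z\<^sup>*\<close>. The like-projection thus compares \<open>z\<^sup>*\<close> with the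
  image of \<open>F\<close> under \<open>\<psi>\<^sub>w\<close>, and this image is caught between two sets. Every \<open>\<psi>\<^sub>w u\<close> is a pair of an
  \<open>s\<close>-sparse and a \<open>t\<close>-sparse vector (\<open>psi_sparse\<close>). Conversely, every such pair with nonzero first
  component is some \<open>\<psi>\<^sub>w u\<close>, provided its first component agrees with \<open>w\<close> at its own first nonzero
  position (\<open>psi_surj\<close>): the scaling undoes the normalization \<open>u\<^sub>p = 1\<close>, and moves the inverse factor
  to the second component.

  Among all sparse pairs, the nearest ones to \<open>w\<close> are obtained by hard thresholding in each component
  separately: a vector is a nearest \<open>k\<close>-sparse one if it agrees with \<open>w\<close> on its support and its
  \<open>k\<close>-th largest absolute value dominates \<open>w\<close> elsewhere (\<open>hard_threshold_optimal\<close>). As the entries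
  of \<open>w\<close> are \<open>-g\<^sub>i / L\<close> off the support and \<open>z\<^sup>*\<^sub>i - g\<^sub>i / L\<close> on it, this condition is the asserted one,
  which proves sufficiency. For necessity it is enough to compare \<open>z\<^sup>*\<close> with vectors that arise by
  resetting one nonzero entry to that of \<open>w\<close> (\<open>update_optimal\<close>), or by admitting the entry of \<open>w\<close> at a
  new position, at the expense of a smallest nonzero entry once the sparsity bound is reached
  (\<open>threshold_of_optimal\<close>). All of these agree with \<open>w\<close> at their first nonzero position, so they do
  lie in the image of \<open>\<psi>\<^sub>w\<close>.
\<close>

section \<open>Order statistics of the entries of a vector\<close>

text \<open>
  The two counts say that the value is a \<open>k\<close>-th largest entry, ties included. All later arguments
  rest on them, so the sorted list is used only here: position \<open>n - k\<close> of the ascending list has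
  \<open>k - 1\<close> positions after it.
\<close>

lemma kth_largest_count:
  fixes v :: "real^'k"
  assumes "0 < k" "k \<le> CARD('k)"
  shows "kth_largest k v \<in> range (($) v)"
    and "card {i. v $ i > kth_largest k v} < k"
    and "k \<le> card {i. v $ i \<ge> kth_largest k v}"
proof -
  define X where "X = image_mset (\<lambda>i. v $ i) (mset_set UNIV)"
  define xs where "xs = sorted_list_of_multiset X"
  define n where "n = CARD('k)"
  define M where "M = kth_largest k v"
  have mset: "mset xs = X" and sorted: "sorted xs" unfolding xs_def by auto
  have len: "length xs = n"
    by (metis mset size_mset X_def size_image_mset size_mset_set n_def)
  have n: "k \<le> n" using assms n_def by simp
  have M: "M = xs ! (n - k)"
    unfolding M_def kth_largest_def X_def[symmetric] xs_def[symmetric]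
    using assms(1) n len by (subst rev_nth) auto
  have "M \<in> set xs" using M n assms(1) len by simp
  moreover have "set xs = range (($) v)"
    using mset by (metis X_def set_mset_mset set_image_mset finite_set_mset_mset_set finite)
  ultimately show "kth_largest k v \<in> range (($) v)" using M_def by auto
  have cnt: "card {i. P (v $ i)} = card {j. j < n \<and> P (xs ! j)}" for P
  proof -
    have "card {i. P (v $ i)} = size (filter_mset P X)"
      unfolding X_def by (simp add: filter_mset_image_mset)
    also have "\<dots> = length (filter P xs)" by (metis mset mset_filter size_mset)
    finally show ?thesis by (simp add: length_filter_conv_card len)
  qed
  have "{j. j < n \<and> xs ! j > M} \<subseteq> {n - k<..<n}"
  proof
    fix j assume j: "j \<in> {j. j < n \<and> xs ! j > M}"
    have "\<not> j \<le> n - k"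
    proof
      assume "j \<le> n - k"
      then have "xs ! j \<le> M" unfolding M
        using sorted_nth_mono[OF sorted] n assms(1) len by auto
      with j show False by auto
    qed
    with j show "j \<in> {n - k<..<n}" by auto
  qed
  then have "card {j. j < n \<and> xs ! j > M} \<le> card {n - k<..<n}" by (rule card_mono[rotated]) simp
  then show "card {i. v $ i > kth_largest k v} < k"
    using cnt[of "\<lambda>a. a > M"] assms(1) n unfolding M_def by simp
  have "{n - k..<n} \<subseteq> {j. j < n \<and> xs ! j \<ge> M}"
    unfolding M using sorted_nth_mono[OF sorted] len by auto
  then have "card {n - k..<n} \<le> card {j. j < n \<and> xs ! j \<ge> M}" by (rule card_mono[rotated]) simp
  then show "k \<le> card {i. v $ i \<ge> kth_largest k v}"
    using cnt[of "\<lambda>a. a \<ge> M"] n unfolding M_def by simp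
qed

lemma abs_vec_nth [simp]: "\<bar>x :: real^'k\<bar> $ i = \<bar>x $ i\<bar>"
  by (simp add: abs_vec_def)

lemma kth_largest_abs_nonneg:
  fixes x :: "real^'k"
  assumes "0 < k" "k \<le> CARD('k)"
  shows "0 \<le> kth_largest k \<bar>x\<bar>"
proof -
  obtain i where "kth_largest k \<bar>x\<bar> = \<bar>x\<bar> $ i" using kth_largest_count(1)[OF assms, of "\<bar>x\<bar>"] by auto
  then show ?thesis by simp
qed

lemma kth_largest_abs_eq_0:
  fixes x :: "real^'k"
  assumes "0 < k" "k \<le> CARD('k)" "l0norm x < k"
  shows "kth_largest k \<bar>x\<bar> = 0"
proof -
  have "\<not> {i. \<bar>x\<bar> $ i \<ge> kth_largest k \<bar>x\<bar>} \<subseteq> {i. x $ i \<noteq> 0}"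
  proof
    assume "{i. \<bar>x\<bar> $ i \<ge> kth_largest k \<bar>x\<bar>} \<subseteq> {i. x $ i \<noteq> 0}"
    then have "card {i. \<bar>x\<bar> $ i \<ge> kth_largest k \<bar>x\<bar>} \<le> l0norm x"
      unfolding l0norm_def by (rule card_mono[rotated]) simp
    then show False using kth_largest_count(3)[OF assms(1,2), of "\<bar>x\<bar>"] assms(3) by simp
  qed
  then obtain i where "\<bar>x\<bar> $ i \<ge> kth_largest k \<bar>x\<bar>" "x $ i = 0" by auto
  then show ?thesis using kth_largest_abs_nonneg[OF assms(1,2), of x] by simp
qed

lemma kth_largest_abs_le_nonzero:
  fixes x :: "real^'k"
  assumes "0 < k" "k \<le> CARD('k)" "l0norm x \<le> k" "x $ j \<noteq> 0"
  shows "kth_largest k \<bar>x\<bar> \<le> \<bar>x $ j\<bar>"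
proof (rule ccontr)
  assume less: "\<not> ?thesis"
  have "{i. \<bar>x\<bar> $ i \<ge> kth_largest k \<bar>x\<bar>} \<subseteq> {i. x $ i \<noteq> 0} - {j}"
    using less by auto
  then have "card {i. \<bar>x\<bar> $ i \<ge> kth_largest k \<bar>x\<bar>} \<le> card ({i. x $ i \<noteq> 0} - {j})"
    by (rule card_mono[rotated]) simp
  also have "\<dots> < card {i. x $ i \<noteq> 0}" using assms(4) by (intro card_Diff1_less) auto
  finally show False
    using kth_largest_count(3)[OF assms(1,2), of "\<bar>x\<bar>"] assms(3) unfolding l0norm_def by simp
qed

lemma ex_nonzero_le_kth_largest_abs:
  fixes x :: "real^'k"
  assumes "0 < k" "k \<le> CARD('k)" "l0norm x = k"
  obtains j where "x $ j \<noteq> 0" "\<bar>x $ j\<bar> \<le> kth_largest k \<bar>x\<bar>"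
proof -
  have "\<not> {i. x $ i \<noteq> 0} \<subseteq> {i. \<bar>x\<bar> $ i > kth_largest k \<bar>x\<bar>}"
  proof
    assume "{i. x $ i \<noteq> 0} \<subseteq> {i. \<bar>x\<bar> $ i > kth_largest k \<bar>x\<bar>}"
    then have "l0norm x \<le> card {i. \<bar>x\<bar> $ i > kth_largest k \<bar>x\<bar>}"
      unfolding l0norm_def by (rule card_mono[rotated]) simp
    then show False using kth_largest_count(2)[OF assms(1,2), of "\<bar>x\<bar>"] assms(3) by simp
  qed
  then obtain j where "x $ j \<noteq> 0" "\<not> \<bar>x\<bar> $ j > kth_largest k \<bar>x\<bar>" by blast
  then show ?thesis using that[of j] by simp
qed

section \<open>Nearest sparse vectors\<close>

lemma norm_vec_sq:
  fixes v :: "real^'k"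
  shows "(norm v)\<^sup>2 = (\<Sum>i\<in>UNIV. (v $ i)\<^sup>2)"
  by (simp add: norm_vec_def L2_set_def sum_nonneg)

text \<open>
  Among index sets of bounded size, one that holds the largest entries carries the most mass: after
  cancelling the common part, each index of \<open>T - S\<close> contributes at most \<open>M\<^sup>2\<close>, each of \<open>S - T\<close> at
  least \<open>M\<^sup>2\<close>. If \<open>M = 0\<close>, the entries outside \<open>S\<close> vanish, which takes the place of the size bound.
\<close>

lemma sum_squares_le_largest:
  fixes w :: "'k::finite \<Rightarrow> real"
  assumes "\<And>j. j \<in> S \<Longrightarrow> M \<le> \<bar>w j\<bar>" "\<And>j. j \<notin> S \<Longrightarrow> \<bar>w j\<bar> \<le> M" "0 \<le> M"
    and "card T \<le> card S \<or> M = 0"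
  shows "(\<Sum>i\<in>T. (w i)\<^sup>2) \<le> (\<Sum>i\<in>S. (w i)\<^sup>2)"
proof -
  have sq: "\<bar>a\<bar> \<le> \<bar>c\<bar> \<Longrightarrow> a\<^sup>2 \<le> c\<^sup>2" for a c :: real by (simp add: abs_le_square_iff)
  have "(\<Sum>i\<in>T - S. (w i)\<^sup>2) \<le> card (T - S) * M\<^sup>2"
    using assms(2,3) by (intro sum_bounded_above) (auto intro!: sq)
  also have "\<dots> \<le> card (S - T) * M\<^sup>2"
  proof (cases "M = 0")
    case False
    then have "card T \<le> card S" using assms(4) by simp
    then have "card (T - S) \<le> card (S - T)"
      by (metis card_le_sym_Diff finite)
    then show ?thesis by (intro mult_right_mono) auto
  qed simp
  also have "\<dots> \<le> (\<Sum>i\<in>S - T. (w i)\<^sup>2)"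
    using assms(1,3) by (intro sum_bounded_below) (auto intro!: sq)
  finally have "(\<Sum>i\<in>T - S. (w i)\<^sup>2) + (\<Sum>i\<in>T \<inter> S. (w i)\<^sup>2)
      \<le> (\<Sum>i\<in>S - T. (w i)\<^sup>2) + (\<Sum>i\<in>S \<inter> T. (w i)\<^sup>2)"
    by (simp add: Int_commute)
  then show ?thesis
    by (metis sum.Int_Diff[OF finite] add.commute)
qed

text \<open>
  The squared distance from \<open>w\<close> of a vector with support \<open>T\<close> is at least the mass of \<open>w\<close> outside \<open>T\<close>,
  with equality for \<open>x\<close>; so the mass on the support of \<open>x\<close> has to be maximal.
\<close>

lemma hard_threshold_optimal:
  fixes x v w :: "real^'k"
  assumes "0 < k" "k \<le> CARD('k)" "x \<in> F2 k" "v \<in> F2 k"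
    and agree: "\<And>i. x $ i \<noteq> 0 \<Longrightarrow> w $ i = x $ i"
    and small: "\<And>i. x $ i = 0 \<Longrightarrow> \<bar>w $ i\<bar> \<le> kth_largest k \<bar>x\<bar>"
  shows "norm (x - w) \<le> norm (v - w)"
proof -
  define S where "S = {i. x $ i \<noteq> 0}"
  define T where "T = {i. v $ i \<noteq> 0}"
  have cx: "l0norm x \<le> k" and cv: "l0norm v \<le> k" using assms unfolding F2_def by auto
  have "(\<Sum>i\<in>T. (w $ i)\<^sup>2) \<le> (\<Sum>i\<in>S. (w $ i)\<^sup>2)"
  proof (rule sum_squares_le_largest[where M = "kth_largest k \<bar>x\<bar>"])
    show "kth_largest k \<bar>x\<bar> \<le> \<bar>w $ j\<bar>" if "j \<in> S" for j
      using that kth_largest_abs_le_nonzero[OF assms(1,2) cx] agree unfolding S_def by auto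
    show "\<bar>w $ j\<bar> \<le> kth_largest k \<bar>x\<bar>" if "j \<notin> S" for j using that small unfolding S_def by auto
    show "0 \<le> kth_largest k \<bar>x\<bar>" by (rule kth_largest_abs_nonneg[OF assms(1,2)])
    show "card T \<le> card S \<or> kth_largest k \<bar>x\<bar> = 0"
      using kth_largest_abs_eq_0[OF assms(1,2), of x] cx cv unfolding S_def T_def l0norm_def
      by linarith
  qed
  then have mass: "(\<Sum>i\<in>-S. (w $ i)\<^sup>2) \<le> (\<Sum>i\<in>-T. (w $ i)\<^sup>2)"
    using sum.Int_Diff[of UNIV "\<lambda>i. (w $ i)\<^sup>2" S] sum.Int_Diff[of UNIV "\<lambda>i. (w $ i)\<^sup>2" T]
    by (simp add: Compl_eq_Diff_UNIV)
  have "(norm (x - w))\<^sup>2 = (\<Sum>i\<in>-S. (w $ i)\<^sup>2)"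
    unfolding norm_vec_sq using agree by (intro sum.mono_neutral_cong_right) (auto simp: S_def)
  also note mass
  also have "(\<Sum>i\<in>-T. (w $ i)\<^sup>2) = (\<Sum>i\<in>-T. ((v - w) $ i)\<^sup>2)"
    by (intro sum.cong) (auto simp: T_def)
  also have "\<dots> \<le> (norm (v - w))\<^sup>2"
    unfolding norm_vec_sq by (intro sum_mono2) auto
  finally show ?thesis by (rule power2_le_imp_le) simp
qed

definition vec_upd :: "real^'k \<Rightarrow> 'k \<Rightarrow> real \<Rightarrow> real^'k" where
  "vec_upd x i c = (\<chi> j. if j = i then c else x $ j)"

lemma vec_upd_nth [simp]: "vec_upd x i c $ j = (if j = i then c else x $ j)"
  by (simp add: vec_upd_def)

lemma norm_vec_upd_sq:
  "(norm (vec_upd x i c - w))\<^sup>2 = (norm (x - w))\<^sup>2 - (x $ i - w $ i)\<^sup>2 + (c - w $ i)\<^sup>2"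
proof -
  have "(\<Sum>j\<in>UNIV - {i}. ((vec_upd x i c - w) $ j)\<^sup>2) = (\<Sum>j\<in>UNIV - {i}. ((x - w) $ j)\<^sup>2)"
    by (intro sum.cong) auto
  then show ?thesis
    unfolding norm_vec_sq sum.remove[OF finite UNIV_I, of _ i] by simp
qed

lemma update_optimal:
  assumes "norm (x - w) \<le> norm (vec_upd x i (w $ i) - w)"
  shows "x $ i = w $ i"
proof -
  have "(norm (x - w))\<^sup>2 \<le> (norm (vec_upd x i (w $ i) - w))\<^sup>2"
    using assms by (rule power_mono) simp
  then have "(x $ i - w $ i)\<^sup>2 \<le> 0" unfolding norm_vec_upd_sq by simp
  then show ?thesis by simp
qed

lemma vec_upd_sparse:
  assumes "x \<in> F2 k" "x $ i \<noteq> 0"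
  shows "vec_upd x i c \<in> F2 k"
proof -
  have "card {j. vec_upd x i c $ j \<noteq> 0} \<le> card {j. x $ j \<noteq> 0}"
    using assms(2) by (intro card_mono) auto
  then show ?thesis using assms(1) unfolding F2_def l0norm_def by auto
qed

text \<open>
  If fewer than \<open>k\<close> entries are used, the new entry \<open>w\<^sub>i\<close> can simply be added; otherwise it replaces
  an entry \<open>x\<^sub>j\<close> of absolute value at most the \<open>k\<close>-th largest, which changes the squared distance by
  \<open>x\<^sub>j\<^sup>2 - w\<^sub>i\<^sup>2\<close>. Both competitors are nonzero and agree with \<open>w\<close> on their support, and asking for
  optimality against such vectors only is what makes the lemma fit the image of \<open>\<psi>\<^sub>w\<close>.
\<close>

lemma threshold_of_optimal:
  fixes x w :: "real^'k"
  assumes "0 < k" "k \<le> CARD('k)" "x \<in> F2 k"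
    and agree: "\<And>j. x $ j \<noteq> 0 \<Longrightarrow> x $ j = w $ j"
    and opt: "\<And>v. v \<in> F2 k \<Longrightarrow> v \<noteq> 0 \<Longrightarrow> (\<And>j. v $ j \<noteq> 0 \<Longrightarrow> v $ j = w $ j)
                \<Longrightarrow> norm (x - w) \<le> norm (v - w)"
    and i: "x $ i = 0"
  shows "\<bar>w $ i\<bar> \<le> kth_largest k \<bar>x\<bar>"
proof (cases "w $ i = 0")
  case True
  then show ?thesis using kth_largest_abs_nonneg[OF assms(1,2), of x] by simp
next
  case wi: False
  have nz: "v \<noteq> 0" if "v $ i = w $ i" for v using that wi by (metis zero_index)
  show ?thesis
  proof (cases "l0norm x < k")
    case True
    define v where "v = vec_upd x i (w $ i)"
    have "{j. v $ j \<noteq> 0} = insert i {j. x $ j \<noteq> 0}" using wi by (auto simp: v_def)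
    then have "l0norm v = Suc (l0norm x)" unfolding l0norm_def using i by simp
    then have "v \<in> F2 k" using True unfolding F2_def by simp
    moreover have "v \<noteq> 0" by (rule nz) (simp add: v_def)
    moreover have "v $ j = w $ j" if "v $ j \<noteq> 0" for j
      using that agree by (auto simp: v_def split: if_splits)
    ultimately have "norm (x - w) \<le> norm (v - w)" by (rule opt)
    then have "x $ i = w $ i" unfolding v_def by (rule update_optimal)
    then show ?thesis using wi i by simp
  next
    case False
    then have "l0norm x = k" using assms(3) unfolding F2_def by simp
    then obtain j where j: "x $ j \<noteq> 0" "\<bar>x $ j\<bar> \<le> kth_largest k \<bar>x\<bar>"
      using ex_nonzero_le_kth_largest_abs[OF assms(1,2)] by blast
    have ij: "i \<noteq> j" using i j by auto
    define v where "v = vec_upd (vec_upd x j 0) i (w $ i)"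
    have "{a. v $ a \<noteq> 0} = insert i ({a. x $ a \<noteq> 0} - {j})"
      using wi ij by (auto simp: v_def)
    then have "l0norm v \<le> l0norm x" unfolding l0norm_def
      using i j(1) card_Suc_Diff1[of "{a. x $ a \<noteq> 0}" j] by simp
    then have "v \<in> F2 k" using assms(3) unfolding F2_def by simp
    moreover have "v \<noteq> 0" by (rule nz) (simp add: v_def)
    moreover have "v $ a = w $ a" if "v $ a \<noteq> 0" for a
      using that agree by (auto simp: v_def split: if_splits)
    ultimately have "norm (x - w) \<le> norm (v - w)" by (rule opt)
    then have "(norm (x - w))\<^sup>2 \<le> (norm (v - w))\<^sup>2" by (rule power_mono) simp
    then have "(w $ i)\<^sup>2 \<le> (x $ j)\<^sup>2"
      unfolding v_def norm_vec_upd_sq using i ij agree[OF j(1)] by simp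
    then have "\<bar>w $ i\<bar> \<le> \<bar>x $ j\<bar>" by (simp add: abs_le_square_iff)
    then show ?thesis using j(2) by simp
  qed
qed

section \<open>The image of the feasible set under the scaling map\<close>

lemma F2_scaleR:
  assumes "x \<in> F2 k"
  shows "c *\<^sub>R x \<in> F2 k"
proof -
  have "l0norm (c *\<^sub>R x) \<le> l0norm x"
    unfolding l0norm_def by (intro card_mono) auto
  then show ?thesis using assms unfolding F2_def by simp
qed

lemma F1_iff: "x \<in> F1 k \<longleftrightarrow> x \<noteq> 0 \<and> x \<in> F2 k \<and> x $ first_nz x = 1"
  unfolding F1_def F2_def by simp

lemma first_nz_nonzero:
  assumes "x \<noteq> 0"
  shows "x $ first_nz x \<noteq> 0"
proof -
  have "{i. x $ i \<noteq> 0} \<noteq> {}" using assms by (auto simp: vec_eq_iff)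
  then have "first_nz x \<in> {i. x $ i \<noteq> 0}" unfolding first_nz_def by (intro Min_in) auto
  then show ?thesis by simp
qed

lemma first_nz_le: "x $ i \<noteq> 0 \<Longrightarrow> first_nz x \<le> i"
  unfolding first_nz_def by simp

lemma psi_sparse:
  assumes "u \<in> feasible s t"
  shows "fst (psi w u) \<in> F2 s" "snd (psi w u) \<in> F2 t"
  using assms unfolding psi_def feasible_def by (auto simp: Let_def F1_iff F2_scaleR)

text \<open>
  Normalizing the first component and compensating in the second yields a preimage. The first common
  nonzero position of preimage and \<open>w\<close> is the first nonzero position of \<open>fst v\<close>, because \<open>w\<close> does
  not vanish there; the agreement hypothesis says that \<open>\<psi>\<^sub>w\<close> scales back by the factor that was divided out.
\<close>

lemma psi_surj:
  assumes "fst v \<in> F2 s" "fst v \<noteq> 0" "snd v \<in> F2 t"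
    and agree: "fst v $ first_nz (fst v) = fst w $ first_nz (fst v)"
  obtains u where "u \<in> feasible s t" "u \<in> psi_dom w" "psi w u = v"
proof -
  define p where "p = first_nz (fst v)"
  define c where "c = fst v $ p"
  have c: "c \<noteq> 0" unfolding c_def p_def using assms(2) by (rule first_nz_nonzero)
  have wp: "fst w $ p = c" using agree unfolding c_def p_def by simp
  define u where "u = ((1 / c) *\<^sub>R fst v, c *\<^sub>R snd v)"
  have nz: "fst u $ i \<noteq> 0 \<longleftrightarrow> fst v $ i \<noteq> 0" for i using c by (simp add: u_def)
  have first: "first_nz (fst u) = p" unfolding p_def first_nz_def nz ..
  have common: "common_nz w u = p"
    unfolding common_nz_def
  proof (rule Min_eqI)
    show "p \<in> {i. fst u $ i \<noteq> 0 \<and> fst w $ i \<noteq> 0}" using c wp nz by (simp add: c_def)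
    show "p \<le> i" if "i \<in> {i. fst u $ i \<noteq> 0 \<and> fst w $ i \<noteq> 0}" for i
      using that nz first_nz_le unfolding p_def by auto
  qed simp
  have "fst w \<noteq> 0" using wp c by (metis zero_index)
  then have "psi w u = v"
    unfolding psi_def common Let_def wp using c by (simp add: u_def)
  moreover have "u \<in> psi_dom w"
    using c wp nz unfolding psi_dom_def by (auto simp: c_def)
  moreover have "u \<in> feasible s t"
    using assms(1-3) c first
    by (auto simp: u_def c_def feasible_def F1_iff intro: F2_scaleR)
  ultimately show ?thesis using that by blast
qed

lemma psi_fixed_point:
  assumes "x \<in> F1 s" "fst w $ first_nz x = 1"
  shows "psi w (x, y) = (x, y)" "(x, y) \<in> psi_dom w"
proof -
  define p where "p = first_nz x"
  have p: "x $ p = 1" "fst w $ p = 1" using assms unfolding F1_def p_def by auto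
  have "common_nz w (x, y) = p"
    unfolding common_nz_def
    by (rule Min_eqI) (use p first_nz_le[of x] in \<open>auto simp: p_def\<close>)
  then show "psi w (x, y) = (x, y)" unfolding psi_def Let_def using p by simp
  show "(x, y) \<in> psi_dom w" unfolding psi_dom_def using p by (auto intro!: exI[of _ p])
qed

section \<open>Characterization of the like-projection\<close>

lemma norm_prod_sq: "(norm (z :: (real^'m) \<times> (real^'n)))\<^sup>2 = (norm (fst z))\<^sup>2 + (norm (snd z))\<^sup>2"
  by (simp add: norm_prod_def)

text \<open>
  The condition is that \<open>x\<close> and \<open>y\<close> are hard thresholds of the components of \<open>w\<close>. Agreement with \<open>w\<close>
  at the first nonzero position of \<open>x\<close> is a hypothesis rather than a consequence of optimality, because
  the scale of \<open>\<psi>\<^sub>w u\<close> is dictated by an entry of \<open>w\<close>; with it, \<open>\<psi>\<^sub>w\<close> fixes \<open>(x, y)\<close>.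
\<close>

lemma like_projection_iff:
  fixes x :: "real^('m::{finite,linorder})" and y :: "real^'n"
  assumes s: "0 < s" "s \<le> CARD('m)" and t: "0 < t" "t \<le> CARD('n)"
    and feas: "(x, y) \<in> feasible s t"
    and agree: "fst w $ first_nz x = 1"
  shows "(x, y) \<in> like_projection (feasible s t) w \<longleftrightarrow>
    (\<forall>i. (x $ i \<noteq> 0 \<longrightarrow> x $ i = fst w $ i) \<and> (x $ i = 0 \<longrightarrow> \<bar>fst w $ i\<bar> \<le> kth_largest s \<bar>x\<bar>)) \<and>
    (\<forall>i. (y $ i \<noteq> 0 \<longrightarrow> y $ i = snd w $ i) \<and> (y $ i = 0 \<longrightarrow> \<bar>snd w $ i\<bar> \<le> kth_largest t \<bar>y\<bar>))"
    (is "?P \<longleftrightarrow> ?Q")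
proof
  have x1: "x \<in> F1 s" and yt: "y \<in> F2 t" using feas unfolding feasible_def by auto
  have xs: "x \<in> F2 s" and x0: "x \<noteq> 0" and xp: "x $ first_nz x = 1"
    using x1 unfolding F1_def F2_def by auto
  note fixed = psi_fixed_point[OF x1 agree, of y]
  {
    assume ?P
    then have min: "\<not> (norm (psi w u - w))\<^sup>2 < (norm ((x, y) - w))\<^sup>2"
      if "u \<in> feasible s t" "u \<in> psi_dom w" for u
      using that fixed(1) unfolding like_projection_def is_arg_min_def mem_Collect_eq by metis
    have opt: "(norm (x - fst w))\<^sup>2 + (norm (y - snd w))\<^sup>2
        \<le> (norm (v1 - fst w))\<^sup>2 + (norm (v2 - snd w))\<^sup>2"
      if v: "v1 \<in> F2 s" "v1 \<noteq> 0" "v2 \<in> F2 t" "v1 $ first_nz v1 = fst w $ first_nz v1"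
      for v1 v2
    proof -
      obtain u where "u \<in> feasible s t" "u \<in> psi_dom w" "psi w u = (v1, v2)"
        using psi_surj[of "(v1, v2)" s t w] v unfolding fst_conv snd_conv by blast
      with min[of u] show ?thesis unfolding norm_prod_sq by simp
    qed
    have opt1: "norm (x - fst w) \<le> norm (v - fst w)"
      if "v \<in> F2 s" "v \<noteq> 0" "v $ first_nz v = fst w $ first_nz v" for v
      using opt[OF that(1,2) yt that(3)] by (auto intro: power2_le_imp_le)
    have opt2: "norm (y - snd w) \<le> norm (v - snd w)" if "v \<in> F2 t" for v
      using opt[OF xs x0 that] xp agree by (auto intro: power2_le_imp_le)
    have eqx: "x $ i = fst w $ i" if i: "x $ i \<noteq> 0" for i
    proof (cases "i = first_nz x")
      case True
      then show ?thesis using xp agree by simp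
    next
      case False
      \<comment> \<open>Changing a nonzero entry after the first one leaves the first nonzero entry, on which the
        scaling depends, in place.\<close>
      define v where "v = vec_upd x i (fst w $ i)"
      have "v $ first_nz x = 1" using False xp by (simp add: v_def)
      then have v0: "v \<noteq> 0" by (metis zero_index zero_neq_one)
      have "first_nz v = first_nz x"
        unfolding first_nz_def[of v]
      proof (rule Min_eqI)
        show "first_nz x \<in> {i. v $ i \<noteq> 0}" using \<open>v $ first_nz x = 1\<close> by simp
        show "first_nz x \<le> j" if "j \<in> {i. v $ i \<noteq> 0}" for j
          using that i first_nz_le[of x] by (auto simp: v_def split: if_splits)
      qed simp
      then have "norm (x - fst w) \<le> norm (v - fst w)"
        using opt1[of v] v0 vec_upd_sparse[OF xs i] \<open>v $ first_nz x = 1\<close> agree by (simp add: v_def)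
      then show ?thesis unfolding v_def by (rule update_optimal)
    qed
    have eqy: "y $ i = snd w $ i" if "y $ i \<noteq> 0" for i
      using opt2[OF vec_upd_sparse[OF yt that]] by (rule update_optimal)
    have "\<bar>fst w $ i\<bar> \<le> kth_largest s \<bar>x\<bar>" if "x $ i = 0" for i
      using s xs eqx _ that
    proof (rule threshold_of_optimal)
      fix v assume "v \<in> F2 s" "v \<noteq> 0" "\<And>j. v $ j \<noteq> 0 \<Longrightarrow> v $ j = fst w $ j"
      then show "norm (x - fst w) \<le> norm (v - fst w)"
        using opt1 first_nz_nonzero by blast
    qed
    moreover have "\<bar>snd w $ i\<bar> \<le> kth_largest t \<bar>y\<bar>" if "y $ i = 0" for i
      using t yt eqy opt2 that by (rule threshold_of_optimal)
    ultimately show ?Q using eqx eqy by blast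
  }
  {
    assume Q: ?Q
    have "(norm ((x, y) - w))\<^sup>2 \<le> (norm (psi w u - w))\<^sup>2" if "u \<in> feasible s t" for u
    proof -
      have "norm (x - fst w) \<le> norm (fst (psi w u) - fst w)"
        using Q by (intro hard_threshold_optimal[OF s xs psi_sparse(1)[OF that]]) auto
      moreover have "norm (y - snd w) \<le> norm (snd (psi w u) - snd w)"
        using Q by (intro hard_threshold_optimal[OF t yt psi_sparse(2)[OF that]]) auto
      ultimately show ?thesis
        unfolding norm_prod_sq by (auto intro!: add_mono power_mono)
    qed
    then show ?P
      using feas fixed unfolding like_projection_def is_arg_min_def by (auto simp: not_less)
  }
qed

theorem theorem3p13:
  fixes A :: "real^'n^('m::{finite,linorder})^'l" and b :: "real^'l"
    and s t :: nat and L :: real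
    and x :: "real^('m::{finite,linorder})" and y :: "real^'n"
  assumes "0 < s" "s < CARD('m)" "0 < t" "t < CARD('n)"
    and "0 < L"
    and "(x, y) \<in> feasible s t"
  shows "like_stationary L (objective A b) (feasible s t) (x, y) \<longleftrightarrow>
    (\<forall>i. (i \<in> supp (x, y) \<longrightarrow> \<bar>coord (grad (objective A b) (x, y)) i\<bar> = 0) \<and>
         (i \<in> I1 - supp (x, y) \<inter> I1 \<longrightarrow>
            \<bar>coord (grad (objective A b) (x, y)) i\<bar> \<le> L * kth_largest s \<bar>x\<bar>) \<and>
         (i \<in> I2 - supp (x, y) \<inter> I2 \<longrightarrow>
            \<bar>coord (grad (objective A b) (x, y)) i\<bar> \<le> L * kth_largest t \<bar>y\<bar>))"
proof -
  define g where "g = grad (objective A b) (x, y)"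
  define w where "w = (x, y) - (1 / L) *\<^sub>R g"
  have w: "fst w $ i = x $ i - fst g $ i / L" "snd w $ j = y $ j - snd g $ j / L" for i j
    unfolding w_def by auto
  have xp: "x $ first_nz x = 1" using assms(6) unfolding feasible_def F1_def by auto
  have zero: "a = a - c / L \<longleftrightarrow> c = 0" for a c using assms(5) by simp
  have bound: "\<bar>0 - c / L\<bar> \<le> M \<longleftrightarrow> \<bar>c\<bar> \<le> L * M" for c M
    using assms(5) by (simp add: abs_divide field_simps)
  define Q where "Q \<longleftrightarrow>
    (\<forall>i. (x $ i \<noteq> 0 \<longrightarrow> fst g $ i = 0) \<and> (x $ i = 0 \<longrightarrow> \<bar>fst g $ i\<bar> \<le> L * kth_largest s \<bar>x\<bar>)) \<and>
    (\<forall>i. (y $ i \<noteq> 0 \<longrightarrow> snd g $ i = 0) \<and> (y $ i = 0 \<longrightarrow> \<bar>snd g $ i\<bar> \<le> L * kth_largest t \<bar>y\<bar>))"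
  have proj: "(x, y) \<in> like_projection (feasible s t) w \<longleftrightarrow> Q" if "fst g $ first_nz x = 0"
  proof -
    have "fst w $ first_nz x = 1" using that xp w by simp
    from like_projection_iff[OF assms(1) less_imp_le[OF assms(2)] assms(3) less_imp_le[OF assms(4)]
        assms(6) this]
    show ?thesis unfolding Q_def w zero using bound by (metis (no_types, lifting))
  qed
  \<comment> \<open>The first nonzero position lies in the support, so the right-hand side contains the separate
    condition of stationarity on the gradient there.\<close>
  have "Q \<Longrightarrow> fst g $ first_nz x = 0" using xp unfolding Q_def by (metis zero_neq_one)
  then have "like_stationary L (objective A b) (feasible s t) (x, y) \<longleftrightarrow> Q"
    using proj assms(6) unfolding like_stationary_def g_def[symmetric] w_def[symmetric]
    by (auto simp: coord_def)
  also have "Q \<longleftrightarrow> (\<forall>i. (i \<in> supp (x, y) \<longrightarrow> \<bar>coord g i\<bar> = 0) \<and>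
         (i \<in> I1 - supp (x, y) \<inter> I1 \<longrightarrow> \<bar>coord g i\<bar> \<le> L * kth_largest s \<bar>x\<bar>) \<and>
         (i \<in> I2 - supp (x, y) \<inter> I2 \<longrightarrow> \<bar>coord g i\<bar> \<le> L * kth_largest t \<bar>y\<bar>))"
    unfolding Q_def split_sum_all supp_def coord_def by auto
  finally show ?thesis unfolding g_def .
qed

end
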